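(* For $m,k\in\mathbb{N}=\{1,2,3,\dots\}$ and $x\in\mathbb{Z}_p$, $$E_{m,q}^{(k)}(x)=\sum_{j=0}^m\binom{m}{j}q^{jx}E_{m-j,q}^{(k+j,1)}(x)\,E_{j,q}^{(k-1)}.$$
   Context: Let $p$ be an odd prime, $\mathbb{C}_p$ the completion of the algebraic closure of $\mathbb{Q}_p$, with $|p|_p=p^{-1}$. Let $q\in\mathbb{C}_p$ with $|1-q|_p<p^{-1/(p-1)}$; for $x\in\mathbb{Z}_p$ put $q^x=\exp(x\log q)$, $[x]_q=\frac{1-q^x}{1-q}$, $[2]_q=1+q$. For $f:\mathbb{Z}_p\to\mathbb{C}_p$ (uniformly differentiable) define $$\int_{\mathbb{Z}_p}f(x)\,d\mu_{-q}(x)=\lim_{N\to\infty}\frac{[2]_q}{1+q^{p^N}}\sum_{x=0}^{p^N-1}f(x)(-1)^xq^x;$$ multiple integrals are iterated. For $h\in\mathbb{Z}$, $k\in\mathbb{N}$, integers $m\ge0$ and $x\in\mathbb{Z}_p$ define $$E_{m,q}^{(h,k)}(x)=\int_{\mathbb{Z}_p}\cdots\int_{\mathbb{Z}_p}[x+x_1+\cdots+x_k]_q^m\,q^{(h-1)x_1+(h-2)x_2+\cdots+(h-k)x_k}\,d\mu_{-q}(x_1)\cdots d\mu_{-q}(x_k)$$ ($k$-fold integral). Set $E_{m,q}^{(k)}(x)=E_{m,q}^{(k,k)}(x)$ and $E_{j,q}^{(k-1)}=E_{j,q}^{(k-1,k-1)}(0)$ for $k\ge2$; for $k=1$, $E_{j,q}^{(0)}$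 is the empty ($0$-fold) integral of $[0]_q^j$, i.e. $E_{j,q}^{(0)}=1$ if $j=0$ and $0$ if $j\ge1$. *)

theory Defs
  imports "HOL-Analysis.Analysis" "HOL-Computational_Algebra.Polynomial" "HOL-Computational_Algebra.Primes"
begin

text \<open>
  The libraries contain no \<open>p\<close>-adic numbers, so \<open>\<complex>\<^sub>p\<close> is introduced as a structure, determined
  up to isometric isomorphism: a complete field of characteristic 0 whose metric comes from a
  non-Archimedean absolute value \<open>\<bar>x\<bar>\<^sub>p = dist x 0\<close> with \<open>\<bar>p\<bar>\<^sub>p = 1/p\<close>, in which the elements algebraic
  over \<open>\<rat>\<^sub>p\<close> (the completion of \<open>\<rat>\<close>, i.e. its closure) form an algebraically closed dense subset.
\<close>

abbreviation padic_abs :: "'a::{field_char_0, complete_space} \<Rightarrow> real" where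
  "padic_abs x \<equiv> dist x 0"

definition Qp :: "'a::{field_char_0, complete_space} set" where
  "Qp = closure \<rat>"

definition Zp :: "'a::{field_char_0, complete_space} set" where
  "Zp = {x \<in> Qp. padic_abs x \<le> 1}"

definition Qp_bar :: "'a::{field_char_0, complete_space} set" where
  "Qp_bar = {x. \<exists>P. P \<noteq> 0 \<and> (\<forall>i. coeff P i \<in> Qp) \<and> poly P x = 0}"

locale padic_complex_field =
  fixes p :: nat
  assumes prime_p: "prime p"
    and dist_eq_abs_diff: "\<And>x y :: 'a::{field_char_0, complete_space}. dist x y = padic_abs (x - y)"
    and abs_mult: "\<And>x y :: 'a. padic_abs (x * y) = padic_abs x * padic_abs y"
    and abs_add_le_max: "\<And>x y :: 'a. padic_abs (x + y) \<le> max (padic_abs x) (padic_abs y)"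
    and abs_p: "padic_abs (of_nat p :: 'a) = 1 / real p"
    and alg_closed_Qp_bar:
      "\<And>P :: 'a poly. (\<forall>i. coeff P i \<in> Qp_bar) \<Longrightarrow> degree P > 0 \<Longrightarrow> \<exists>x\<in>Qp_bar. poly P x = 0"
    and dense_Qp_bar: "closure (Qp_bar :: 'a set) = UNIV"

definition padic_exp :: "'a::{field_char_0, complete_space} \<Rightarrow> 'a" where
  "padic_exp z = (\<Sum>n. z ^ n / fact n)"

definition padic_log :: "'a::{field_char_0, complete_space} \<Rightarrow> 'a" where
  "padic_log y = (\<Sum>n. (- 1) ^ n * (y - 1) ^ Suc n / of_nat (Suc n))"

definition qpow :: "'a::{field_char_0, complete_space} \<Rightarrow> 'a \<Rightarrow> 'a" where
  "qpow q x = padic_exp (x * padic_log q)"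

text \<open>For \<open>q = 1\<close> the quotient is \<open>0/0\<close>; it is read as its limit \<open>x\<close> for \<open>q \<rightarrow> 1\<close>.\<close>

definition qnum :: "'a::{field_char_0, complete_space} \<Rightarrow> 'a \<Rightarrow> 'a" where
  "qnum q x = (if q = 1 then x else (1 - qpow q x) / (1 - q))"

definition fermionic_integral ::
    "nat \<Rightarrow> 'a::{field_char_0, complete_space} \<Rightarrow> ('a \<Rightarrow> 'a) \<Rightarrow> 'a" where
  "fermionic_integral p q f =
     lim (\<lambda>N. (1 + q) / (1 + qpow q (of_nat (p ^ N))) *
              (\<Sum>x<p ^ N. f (of_nat x) * (- 1) ^ x * qpow q (of_nat x)))"

text \<open>
  Integrands of \<open>k\<close> variables are functions of \<open>y\<close> depending only on \<open>y 1, \<dots>, y k\<close>;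
  the integral over \<open>y 1\<close> is the innermost one.
\<close>

fun iterated_integral ::
    "nat \<Rightarrow> 'a::{field_char_0, complete_space} \<Rightarrow> nat \<Rightarrow> ((nat \<Rightarrow> 'a) \<Rightarrow> 'a) \<Rightarrow> 'a" where
  "iterated_integral p q 0 F = F (\<lambda>_. 0)"
| "iterated_integral p q (Suc k) F =
     fermionic_integral p q (\<lambda>t. iterated_integral p q k (\<lambda>y. F (y(Suc k := t))))"

definition qEuler ::
    "nat \<Rightarrow> 'a::{field_char_0, complete_space} \<Rightarrow> int \<Rightarrow> nat \<Rightarrow> nat \<Rightarrow> 'a \<Rightarrow> 'a" where
  "qEuler p q h k m x =
     iterated_integral p q k
       (\<lambda>y. qnum q (x + (\<Sum>i=1..k. y i)) ^ m * qpow q (\<Sum>i=1..k. of_int (h - int i) * y i))"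

end

theory Submission
  imports Defs
begin

text \<open>
  For \<open>y = x\<^sub>2 + \<dots> + x\<^sub>k\<close> the rule \<open>[x + x\<^sub>1 + y]\<^sub>q = [x + x\<^sub>1]\<^sub>q + q\<^bsup>x + x\<^sub>1\<^esup> [y]\<^sub>q\<close> and the binomial theorem
  split the integrand into products of a function of \<open>x\<^sub>1\<close>, whose integral is \<open>E\<^bsup>(k + j, 1)\<^esup>(x)\<close>, and a
  function of \<open>x\<^sub>2, \<dots>, x\<^sub>k\<close>, whose integral is \<open>E\<^bsup>(k - 1)\<^esup>\<close>. Integrating termwise needs the limits to
  exist. This holds for every integrand that is uniformly continuous on \<open>\<nat>\<close> in the \<open>p\<close>-adic sense, and
  the iterated integrals stay in this class. The functional equation of \<open>q\<^sup>x\<close> comes from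
  \<open>\<bar>n!\<bar>\<^sub>p \<ge> r\<^bsup>n - 1\<^esup>\<close> with \<open>r = p\<^bsup>-1/(p-1)\<^esup>\<close>, which gives both \<open>\<bar>log q\<bar>\<^sub>p \<le> \<bar>1 - q\<bar>\<^sub>p < r\<close> and the
  convergence of \<open>exp\<close> on the disc of radius \<open>r\<close>.
\<close>

context padic_complex_field
begin

section \<open>Ultrametric preliminaries\<close>

lemma abs_1 [simp]: "padic_abs (1::'a) = 1"
proof -
  have "padic_abs (1::'a) * padic_abs (1::'a) = padic_abs (1::'a)"
    using abs_mult[of 1 1] by simp
  then show ?thesis by simp
qed

lemma abs_minus [simp]: "padic_abs (- x :: 'a) = padic_abs x"
  using dist_eq_abs_diff[of 0 x] by (simp add: dist_commute)

lemma abs_diff_commute: "padic_abs (x - y :: 'a) = padic_abs (y - x)"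
  using abs_minus[of "y - x"] by simp

lemma abs_diff_le_max: "padic_abs (x - y :: 'a) \<le> max (padic_abs x) (padic_abs y)"
  using abs_add_le_max[of x "- y"] by simp

lemma abs_power: "padic_abs (x ^ n :: 'a) = padic_abs x ^ n"
  by (induction n) (simp_all add: abs_mult)

lemma abs_divide: "padic_abs (x / y :: 'a) = padic_abs x / padic_abs y"
proof (cases "y = 0")
  case False
  then have "padic_abs (x / y) * padic_abs y = padic_abs x"
    using abs_mult[of "x / y" y] by simp
  then show ?thesis using False by (simp add: field_simps)
qed simp

lemma abs_sum_le:
  assumes "\<And>x. x \<in> A \<Longrightarrow> padic_abs (f x :: 'a) \<le> B" and "B \<ge> 0"
  shows "padic_abs (sum f A) \<le> B"
  using assms(1)
proof (induction A rule: infinite_finite_induct)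
  case (insert a A)
  then have "padic_abs (f a) \<le> B" "padic_abs (sum f A) \<le> B" by auto
  then show ?case
    using insert.hyps abs_add_le_max[of "f a" "sum f A"] by simp
qed (use assms(2) in auto)

lemma abs_of_nat_le_1: "padic_abs (of_nat n :: 'a) \<le> 1"
proof (induction n)
  case (Suc n)
  then show ?case using abs_add_le_max[of 1 "of_nat n"] by simp
qed simp

lemma abs_neg_one_power [simp]: "padic_abs ((- 1) ^ n :: 'a) = 1"
  by (simp add: abs_power)

lemma p_gt_1: "p > 1"
  using prime_p by (rule prime_gt_1_nat)

lemma abs_of_nat_coprime:
  assumes "coprime n p"
  shows "padic_abs (of_nat n :: 'a) = 1"
proof -
  obtain a b :: int where "a * int n + b * int p = 1"
    using assms bezout_int[of "int n" "int p"] by (metis coprime_imp_gcd_eq_1 coprime_int_iff)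
  then have eq: "of_int a * of_nat n + of_int b * of_nat p = (1::'a)"
    by (metis of_int_1 of_int_add of_int_mult of_int_of_nat_eq)
  have of_int_le: "padic_abs (of_int z :: 'a) \<le> 1" for z
    by (cases z) (use abs_of_nat_le_1 abs_minus in \<open>simp_all del: of_nat_Suc\<close>)
  have "padic_abs (of_int b * of_nat p :: 'a) \<le> 1 / real p"
    using of_int_le[of b] p_gt_1 by (simp add: abs_mult abs_p divide_right_mono)
  also have "\<dots> < 1" using p_gt_1 by simp
  finally have "1 \<le> padic_abs (of_int a * of_nat n :: 'a)"
    using abs_add_le_max[of "of_int a * of_nat n" "of_int b * of_nat p"] unfolding eq by auto
  also have "\<dots> \<le> padic_abs (of_nat n :: 'a)"
    using of_int_le[of a] by (simp add: abs_mult mult_left_le_one_le)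
  finally show ?thesis using abs_of_nat_le_1[of n] by simp
qed

lemma tendsto_padic_le:
  assumes "\<And>n. padic_abs (X n - L :: 'a) \<le> b n" "b \<longlonglongrightarrow> 0"
  shows "X \<longlonglongrightarrow> L"
proof (rule iffD2[OF tendsto_dist_iff])
  show "(\<lambda>n. dist (X n) L) \<longlonglongrightarrow> 0"
    unfolding dist_eq_abs_diff[of "X _"]
    by (rule tendsto_sandwich[OF _ _ tendsto_const assms(2)]) (auto simp: assms(1))
qed

lemma tendsto_padic_abs_diff: "X \<longlonglongrightarrow> (L::'a) \<Longrightarrow> (\<lambda>n. padic_abs (X n - L)) \<longlonglongrightarrow> 0"
  unfolding dist_eq_abs_diff[of "X _", symmetric] by (rule iffD1[OF tendsto_dist_iff])

lemma tendsto_add_padic: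
  assumes "X \<longlonglongrightarrow> (L::'a)" "Y \<longlonglongrightarrow> M"
  shows "(\<lambda>n. X n + Y n) \<longlonglongrightarrow> L + M"
proof (rule tendsto_padic_le)
  show "(\<lambda>n. padic_abs (X n - L) + padic_abs (Y n - M)) \<longlonglongrightarrow> 0"
    using tendsto_add[OF assms[THEN tendsto_padic_abs_diff]] by simp
  fix n
  have "X n + Y n - (L + M) = (X n - L) + (Y n - M)"
    by simp
  also have "padic_abs \<dots> \<le> padic_abs (X n - L) + padic_abs (Y n - M)"
    by (rule order_trans[OF abs_add_le_max]) simp
  finally show "padic_abs (X n + Y n - (L + M)) \<le> padic_abs (X n - L) + padic_abs (Y n - M)" .
qed

lemma tendsto_mult_padic:
  assumes "X \<longlonglongrightarrow> (L::'a)" "Y \<longlonglongrightarrow> M"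
  shows "(\<lambda>n. X n * Y n) \<longlonglongrightarrow> L * M"
proof (rule tendsto_padic_le)
  let ?a = "\<lambda>n. padic_abs (X n - L)" and ?b = "\<lambda>n. padic_abs (Y n - M)"
  have "(\<lambda>n. ?a n * ?b n + padic_abs L * ?b n + ?a n * padic_abs M)
      \<longlonglongrightarrow> 0 * 0 + padic_abs L * 0 + 0 * padic_abs M"
    by (intro tendsto_add tendsto_mult tendsto_const assms[THEN tendsto_padic_abs_diff])
  then show "(\<lambda>n. ?a n * ?b n + padic_abs L * ?b n + ?a n * padic_abs M) \<longlonglongrightarrow> 0"
    by simp
  fix n
  have "X n * Y n - L * M = ((X n - L) * (Y n - M) + L * (Y n - M)) + (X n - L) * M"
    by (simp add: algebra_simps)
  also have "padic_abs \<dots>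
      \<le> padic_abs ((X n - L) * (Y n - M) + L * (Y n - M)) + padic_abs ((X n - L) * M)"
    by (rule order_trans[OF abs_add_le_max]) simp
  also have "\<dots> \<le> padic_abs ((X n - L) * (Y n - M)) + padic_abs (L * (Y n - M))
      + padic_abs ((X n - L) * M)"
    by (intro add_right_mono order_trans[OF abs_add_le_max]) simp
  finally show "padic_abs (X n * Y n - L * M) \<le> ?a n * ?b n + padic_abs L * ?b n + ?a n * padic_abs M"
    by (simp add: abs_mult)
qed

lemma tendsto_sum_padic:
  assumes "\<And>j. j \<in> J \<Longrightarrow> X j \<longlonglongrightarrow> (L j :: 'a)"
  shows "(\<lambda>n. \<Sum>j\<in>J. X j n) \<longlonglongrightarrow> (\<Sum>j\<in>J. L j)"
  using assms
  by (induction J rule: infinite_finite_induct) (simp_all add: tendsto_add_padic)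

lemma abs_limit_le:
  assumes "X \<longlonglongrightarrow> (L::'a)" "\<And>n. padic_abs (X n - c) \<le> B"
  shows "padic_abs (L - c) \<le> B"
proof -
  have "(\<lambda>n. dist (X n) c) \<longlonglongrightarrow> dist L c"
    by (intro tendsto_intros assms(1))
  then show ?thesis
    using assms(2) unfolding dist_eq_abs_diff[of _ c] by (intro LIMSEQ_le_const2) auto
qed

lemma convergent_padicI:
  assumes "\<And>\<epsilon>. \<epsilon> > 0 \<Longrightarrow> \<exists>N. \<forall>n\<ge>N. padic_abs (X n - X N :: 'a) < \<epsilon>"
  shows "convergent X"
proof -
  have "Cauchy X"
    unfolding Cauchy_altdef2 dist_eq_abs_diff[of "X _"] using assms by blast
  then show ?thesis by (rule Cauchy_convergent)
qed

lemma sums_padic: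
  assumes "\<And>n. padic_abs (f n :: 'a) \<le> b n" "b \<longlonglongrightarrow> 0"
  shows "f sums suminf f"
proof -
  have "convergent (\<lambda>n. sum f {..<n})"
  proof (rule convergent_padicI)
    fix \<epsilon> :: real assume "\<epsilon> > 0"
    then obtain N where N: "b n < \<epsilon> / 2" if "n \<ge> N" for n
      using order_tendstoD(2)[OF assms(2), of "\<epsilon> / 2"] unfolding eventually_sequentially by auto
    have "padic_abs (sum f {..<n} - sum f {..<N}) < \<epsilon>" if "n \<ge> N" for n
    proof -
      have "sum f {..<n} - sum f {..<N} = sum f {N..<n}"
        using that sum_diff_nat_ivl[of 0 N n f] by (simp add: lessThan_atLeast0)
      also have "padic_abs \<dots> \<le> \<epsilon> / 2"
        using \<open>\<epsilon> > 0\<close>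
        by (intro abs_sum_le order_trans[OF assms(1)] less_imp_le[OF N]) auto
      finally show ?thesis using \<open>\<epsilon> > 0\<close> by simp
    qed
    then show "\<exists>N. \<forall>n\<ge>N. padic_abs (sum f {..<n} - sum f {..<N}) < \<epsilon>" by blast
  qed
  then have "summable f"
    by (simp add: summable_iff_convergent)
  then show ?thesis
    unfolding summable_def suminf_def by (metis sums_unique suminf_def)
qed

section \<open>Exponential and logarithm\<close>

definition exp_radius :: real where
  "exp_radius = real p powr (- 1 / (real p - 1))"

lemma exp_radius_pos: "exp_radius > 0"
  using p_gt_1 by (simp add: exp_radius_def)

lemma exp_radius_less_1: "exp_radius < 1"
  unfolding exp_radius_def using p_gt_1 by (subst powr_less_one) auto

lemma exp_radius_power: "exp_radius ^ (p - 1) = 1 / real p"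
proof -
  have "exp_radius ^ (p - 1) = real p powr (- 1 / (real p - 1) * real (p - 1))"
    unfolding exp_radius_def using p_gt_1 by (subst powr_realpow[symmetric]) (auto simp: powr_powr)
  also have "- 1 / (real p - 1) * real (p - 1) = - 1"
    using p_gt_1 by (simp add: of_nat_diff)
  finally show ?thesis using p_gt_1 by (simp add: powr_minus field_simps)
qed

lemma abs_fact_div:
  "padic_abs (fact n :: 'a) = (1 / real p) ^ (n div p) * padic_abs (fact (n div p) :: 'a)"
proof (induction n)
  case (Suc n)
  show ?case
  proof (cases "p dvd Suc n")
    case True
    then obtain c where c: "Suc n = p * c" by blast
    have "Suc n div p = Suc (n div p)"
      using True by (simp add: div_Suc dvd_eq_mod_eq_0)
    moreover have "Suc n div p = c" using c p_gt_1 by simp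
    ultimately have d: "Suc n = p * Suc (n div p)" "Suc n div p = Suc (n div p)" using c by auto
    have "padic_abs (fact (Suc n) :: 'a) = padic_abs (of_nat (Suc n) :: 'a) * padic_abs (fact n :: 'a)"
      by (simp add: abs_mult del: of_nat_Suc)
    also have "\<dots> = 1 / real p * padic_abs (of_nat (Suc (n div p)) :: 'a) * padic_abs (fact n :: 'a)"
      by (subst d(1)) (simp only: of_nat_mult abs_mult abs_p)
    finally show ?thesis
      unfolding Suc.IH d(2) by (simp add: abs_mult del: of_nat_Suc)
  next
    case False
    then have "Suc n div p = n div p"
      by (simp add: div_Suc dvd_eq_mod_eq_0)
    moreover have "coprime (Suc n) p"
      using False prime_p by (metis coprime_commute prime_imp_coprime)
    ultimately show ?thesis
      using Suc.IH abs_of_nat_coprime[of "Suc n"] by (simp add: abs_mult del: of_nat_Suc)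
  qed
qed simp

lemma abs_fact_ge: "exp_radius ^ (n - 1) \<le> padic_abs (fact n :: 'a)"
proof (induction n rule: less_induct)
  case (less n)
  show ?case
  proof (cases "n div p = 0")
    case True
    then have "padic_abs (fact n :: 'a) = 1" using abs_fact_div[of n] by simp
    then show ?thesis
      using exp_radius_pos exp_radius_less_1 by (simp add: power_le_one)
  next
    case False
    let ?m = "n div p"
    have "n > 0" using False by (cases n) auto
    then have "?m < n" using p_gt_1 by simp
    have le: "(p - 1) * ?m + (?m - 1) \<le> n - 1"
    proof -
      have "(p - 1) * ?m + (?m - 1) = p * ?m - 1"
        using False p_gt_1 by (cases p) auto
      then show ?thesis using times_div_less_eq_dividend[of p n] by (simp only: diff_le_mono)
    qed
    have "exp_radius ^ (n - 1) \<le> exp_radius ^ ((p - 1) * ?m + (?m - 1))"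
      using exp_radius_pos exp_radius_less_1 le by (intro power_decreasing) auto
    also have "\<dots> = (1 / real p) ^ ?m * exp_radius ^ (?m - 1)"
      by (simp only: power_add power_mult exp_radius_power)
    also have "\<dots> \<le> (1 / real p) ^ ?m * padic_abs (fact ?m :: 'a)"
      using less.IH[OF \<open>?m < n\<close>] by (intro mult_left_mono) auto
    finally show ?thesis using abs_fact_div[of n] by simp
  qed
qed

lemma abs_of_nat_ge:
  assumes "n > 0"
  shows "exp_radius ^ (n - 1) \<le> padic_abs (of_nat n :: 'a)"
proof -
  have "(fact n :: 'a) = of_nat n * of_nat (fact (n - 1))"
    using assms by (simp add: fact_reduce)
  then have "padic_abs (fact n :: 'a) \<le> padic_abs (of_nat n :: 'a)"
    using abs_of_nat_le_1[of "fact (n - 1)"] by (simp only: abs_mult mult_left_le zero_le_dist)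
  then show ?thesis using abs_fact_ge[of n] by linarith
qed

lemma abs_power_divide_le:
  assumes "n > 0" "exp_radius ^ (n - 1) \<le> padic_abs d"
  shows "padic_abs (z ^ n / d :: 'a) \<le> padic_abs z * (padic_abs z / exp_radius) ^ (n - 1)"
proof -
  obtain l where n: "n = Suc l" using assms(1) gr0_implies_Suc by blast
  have "padic_abs (z ^ n / d) = padic_abs z ^ n / padic_abs d"
    by (simp add: abs_divide abs_power)
  also have "\<dots> \<le> padic_abs z ^ n / exp_radius ^ (n - 1)"
  proof -
    have "exp_radius ^ (n - 1) > 0" using exp_radius_pos by simp
    then show ?thesis using assms(2) by (intro divide_left_mono mult_pos_pos) auto
  qed
  also have "\<dots> = padic_abs z * (padic_abs z / exp_radius) ^ (n - 1)"
    by (simp add: n power_divide)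
  finally show ?thesis .
qed

lemma quotient_exp_radius:
  assumes "padic_abs (z::'a) < exp_radius"
  shows "0 \<le> padic_abs z / exp_radius" "padic_abs z / exp_radius < 1"
    "(\<lambda>n. (padic_abs z / exp_radius) ^ n) \<longlonglongrightarrow> 0"
proof -
  show *: "0 \<le> padic_abs z / exp_radius" "padic_abs z / exp_radius < 1"
    using assms exp_radius_pos by auto
  show "(\<lambda>n. (padic_abs z / exp_radius) ^ n) \<longlonglongrightarrow> 0"
    using * by (intro LIMSEQ_realpow_zero)
qed

lemma abs_exp_term_le:
  assumes "padic_abs (z::'a) < exp_radius"
  shows "padic_abs (z ^ n / fact n) \<le> (padic_abs z / exp_radius) ^ n"
proof (cases "n = 0")
  case False
  let ?c = "padic_abs z / exp_radius"
  have "padic_abs (z ^ n / fact n) \<le> padic_abs z * ?c ^ (n - 1)"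
    using False abs_fact_ge by (intro abs_power_divide_le) auto
  also have "\<dots> \<le> ?c * ?c ^ (n - 1)"
  proof (rule mult_right_mono)
    have "padic_abs z * exp_radius \<le> padic_abs z"
      using exp_radius_less_1 by (simp add: mult_left_le)
    then show "padic_abs z \<le> ?c" using exp_radius_pos by (simp add: field_simps)
  qed (use quotient_exp_radius[OF assms] in auto)
  also have "\<dots> = ?c ^ n" using False by (simp add: power_eq_if)
  finally show ?thesis .
qed (simp add: abs_divide)

lemma padic_exp_sums:
  assumes "padic_abs (z::'a) < exp_radius"
  shows "(\<lambda>n. \<Sum>i<n. z ^ i / fact i) \<longlonglongrightarrow> padic_exp z"
  using sums_padic[OF abs_exp_term_le[OF assms] quotient_exp_radius(3)[OF assms]]
  unfolding padic_exp_def sums_def .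

lemma abs_power_divide_le_abs:
  assumes "padic_abs (z::'a) < exp_radius" "n > 0" "exp_radius ^ (n - 1) \<le> padic_abs d"
  shows "padic_abs (z ^ n / d) \<le> padic_abs z"
proof -
  have "(padic_abs z / exp_radius) ^ (n - 1) \<le> 1"
    using quotient_exp_radius[OF assms(1)] by (intro power_le_one) auto
  then have "padic_abs z * (padic_abs z / exp_radius) ^ (n - 1) \<le> padic_abs z"
    by (intro mult_left_le) auto
  then show ?thesis using abs_power_divide_le[OF assms(2,3), of z] by linarith
qed

lemma abs_padic_exp_minus_1_le:
  assumes "padic_abs (z::'a) < exp_radius"
  shows "padic_abs (padic_exp z - 1) \<le> padic_abs z"
proof (rule abs_limit_le)
  show "(\<lambda>n. \<Sum>i<Suc n. z ^ i / fact i) \<longlonglongrightarrow> padic_exp z"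
    using padic_exp_sums[OF assms] by (rule LIMSEQ_Suc)
  fix n
  have "(\<Sum>i<Suc n. z ^ i / fact i) - 1 = (\<Sum>i<n. z ^ Suc i / fact (Suc i))"
    by (subst sum.lessThan_Suc_shift) simp
  also have "padic_abs \<dots> \<le> padic_abs z"
    by (intro abs_sum_le abs_power_divide_le_abs assms abs_fact_ge) auto
  finally show "padic_abs ((\<Sum>i<Suc n. z ^ i / fact i) - 1) \<le> padic_abs z" .
qed

lemma abs_padic_log_le:
  assumes "padic_abs (1 - y :: 'a) < exp_radius"
  shows "padic_abs (padic_log y) \<le> padic_abs (1 - y)"
proof -
  let ?z = "y - 1"
  let ?f = "\<lambda>n. (- 1) ^ n * (y - 1) ^ Suc n / of_nat (Suc n)"
  have z: "padic_abs ?z = padic_abs (1 - y)" by (rule abs_diff_commute)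
  then have lt: "padic_abs ?z < exp_radius" using assms by simp
  have eq: "padic_abs (?f n) = padic_abs (?z ^ Suc n / of_nat (Suc n))" for n
    by (simp only: abs_divide abs_mult abs_neg_one_power mult_1)
  have "?f sums suminf ?f"
  proof (rule sums_padic)
    show "padic_abs (?f n) \<le> padic_abs ?z * (padic_abs ?z / exp_radius) ^ n" for n
      unfolding eq using abs_power_divide_le[of "Suc n" "of_nat (Suc n)" ?z] abs_of_nat_ge[of "Suc n"]
      by simp
    show "(\<lambda>n. padic_abs ?z * (padic_abs ?z / exp_radius) ^ n) \<longlonglongrightarrow> 0"
      using tendsto_mult_left[OF quotient_exp_radius(3)[OF lt]] by fastforce
  qed
  then have "(\<lambda>n. \<Sum>i<n. ?f i) \<longlonglongrightarrow> padic_log y"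
    unfolding padic_log_def sums_def .
  moreover have "padic_abs ((\<Sum>i<n. ?f i) - 0) \<le> padic_abs ?z" for n
    unfolding diff_0_right
    by (intro abs_sum_le) (unfold eq, auto intro!: abs_power_divide_le_abs lt abs_of_nat_ge
        simp del: of_nat_Suc power_Suc)
  ultimately have "padic_abs (padic_log y - 0) \<le> padic_abs ?z"
    by (rule abs_limit_le)
  then show ?thesis using z by simp
qed

lemma padic_exp_add:
  assumes "padic_abs (z::'a) < exp_radius" "padic_abs w < exp_radius"
  shows "padic_exp (z + w) = padic_exp z * padic_exp w"
proof -
  define c where "c = max (padic_abs z / exp_radius) (padic_abs w / exp_radius)"
  have c: "0 \<le> c" "c < 1"
    using quotient_exp_radius[OF assms(1)] quotient_exp_radius[OF assms(2)] by (auto simp: c_def)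
  define e where "e u n = (\<Sum>i<n. u ^ i / fact i)" for u :: 'a and n
  have bound: "padic_abs (u ^ i / fact i) \<le> c ^ i" if "u = z \<or> u = w" for u i
  proof -
    have "padic_abs (u ^ i / fact i) \<le> (padic_abs u / exp_radius) ^ i"
      using that assms by (intro abs_exp_term_le) auto
    also have "\<dots> \<le> c ^ i"
      using that exp_radius_pos by (intro power_mono) (auto simp: c_def)
    finally show ?thesis .
  qed
  have diff: "padic_abs (e z n * e w n - e (z + w) n) \<le> c ^ n" for n
  proof -
    let ?t = "\<lambda>(i, j). (z ^ i / fact i) * (w ^ j / fact j)"
    let ?T = "{(i, j). i + j < n}"
    have sub: "?T \<subseteq> {..<n} \<times> {..<n}" by auto
    have "e (z + w) n = (\<Sum>k<n. \<Sum>i\<le>k. ?t (i, k - i))"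
      unfolding e_def
    proof (rule sum.cong[OF refl])
      fix k
      have "(z + w) ^ k / fact k = (\<Sum>i\<le>k. of_nat (k choose i) * z ^ i * w ^ (k - i) / fact k)"
        by (simp add: binomial_ring sum_divide_distrib)
      also have "\<dots> = (\<Sum>i\<le>k. ?t (i, k - i))"
        by (intro sum.cong) (auto simp: binomial_fact field_simps)
      finally show "(z + w) ^ k / fact k = (\<Sum>i\<le>k. ?t (i, k - i))" .
    qed
    also have "\<dots> = sum ?t ?T"
      using sum.triangle_reindex[of "\<lambda>i j. ?t (i, j)" n] by simp
    finally have 1: "e (z + w) n = sum ?t ?T" .
    have 2: "e z n * e w n = sum ?t ({..<n} \<times> {..<n})"
      unfolding e_def sum_product by (simp add: sum.cartesian_product)
    have "e z n * e w n - e (z + w) n = sum ?t ({..<n} \<times> {..<n} - ?T)"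
      unfolding 1 2 using sub by (subst sum_diff) auto
    also have "padic_abs \<dots> \<le> c ^ n"
    proof (rule abs_sum_le)
      fix x assume "x \<in> {..<n} \<times> {..<n} - ?T"
      then obtain i j where x: "x = (i, j)" "n \<le> i + j" by (cases x) auto
      have "padic_abs (?t x) = padic_abs (z ^ i / fact i) * padic_abs (w ^ j / fact j)"
        by (simp only: x(1) prod.case abs_mult)
      also have "\<dots> \<le> c ^ i * c ^ j"
        using c by (intro mult_mono bound) auto
      also have "\<dots> \<le> c ^ n"
        using c x by (simp add: power_add[symmetric] power_decreasing)
      finally show "padic_abs (?t x) \<le> c ^ n" .
    qed (use c in simp)
    finally show ?thesis .
  qed
  have "padic_abs (z + w) < exp_radius"
    using abs_add_le_max[of z w] assms by auto
  then have lim: "e (z + w) \<longlonglongrightarrow> padic_exp (z + w)"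
    unfolding e_def by (rule padic_exp_sums)
  have "(\<lambda>n. e z n * e w n - e (z + w) n) \<longlonglongrightarrow> 0"
    using diff LIMSEQ_realpow_zero[OF c] by (intro tendsto_padic_le[where b = "\<lambda>n. c ^ n"]) auto
  from tendsto_add_padic[OF this lim]
  have "(\<lambda>n. e z n * e w n) \<longlonglongrightarrow> padic_exp (z + w)" by simp
  moreover have "(\<lambda>n. e z n * e w n) \<longlonglongrightarrow> padic_exp z * padic_exp w"
    unfolding e_def by (intro tendsto_mult_padic padic_exp_sums assms)
  ultimately show ?thesis by (rule LIMSEQ_unique)
qed

section \<open>Uniformly continuous functions\<close>

definition padic_continuous :: "(nat \<Rightarrow> 'a) \<Rightarrow> bool" where
  "padic_continuous f \<longleftrightarrow> (\<forall>\<epsilon>>0. \<exists>N. \<forall>n i. padic_abs (f (n + i * p ^ N) - f n) < \<epsilon>)"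

lemma padic_continuousD:
  assumes "padic_continuous f" "\<epsilon> > 0"
  obtains N where "\<And>M n i. M \<ge> N \<Longrightarrow> padic_abs (f (n + i * p ^ M) - f n) < \<epsilon>"
proof -
  obtain N where N: "padic_abs (f (n + i * p ^ N) - f n) < \<epsilon>" for n i
    using assms unfolding padic_continuous_def by blast
  have "padic_abs (f (n + i * p ^ M) - f n) < \<epsilon>" if "M \<ge> N" for M n i
    using N[of n "i * p ^ (M - N)"] that by (simp add: mult.assoc flip: power_add)
  then show ?thesis using that by blast
qed

lemma padic_continuous_bounded:
  assumes "padic_continuous f"
  obtains B where "B > 0" "\<And>n. padic_abs (f n) \<le> B"
proof -
  obtain N where N: "padic_abs (f (n + i * p ^ N) - f n) < 1" for n i
    using assms unfolding padic_continuous_def by (meson zero_less_one)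
  define B where "B = 1 + (\<Sum>n<p ^ N. padic_abs (f n))"
  have "padic_abs (f n) \<le> B" for n
  proof -
    let ?r = "n mod p ^ N"
    have "?r < p ^ N" using p_gt_1 by simp
    then have "padic_abs (f ?r) \<le> (\<Sum>n<p ^ N. padic_abs (f n))"
      by (intro member_le_sum) auto
    moreover have "padic_abs (f n - f ?r) < 1"
      using N[of ?r "n div p ^ N"] by (simp add: mod_div_mult_eq)
    moreover have "padic_abs (f n) \<le> max (padic_abs (f n - f ?r)) (padic_abs (f ?r))"
      using abs_add_le_max[of "f n - f ?r" "f ?r"] by simp
    ultimately show ?thesis
      unfolding B_def using zero_le_dist[of "f ?r" 0] by linarith
  qed
  moreover have "B > 0"
    unfolding B_def by (intro add_pos_nonneg sum_nonneg) auto
  ultimately show ?thesis using that by blast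
qed

lemma padic_continuous_const: "padic_continuous (\<lambda>n. c)"
  by (simp add: padic_continuous_def)

lemma padic_continuous_add:
  assumes "padic_continuous f" "padic_continuous g"
  shows "padic_continuous (\<lambda>n. f n + g n)"
  unfolding padic_continuous_def
proof (intro allI impI)
  fix \<epsilon> :: real assume "\<epsilon> > 0"
  obtain N where N: "\<And>M n i. M \<ge> N \<Longrightarrow> padic_abs (f (n + i * p ^ M) - f n) < \<epsilon>"
    using padic_continuousD[OF assms(1) \<open>\<epsilon> > 0\<close>] by blast
  obtain N' where N': "\<And>M n i. M \<ge> N' \<Longrightarrow> padic_abs (g (n + i * p ^ M) - g n) < \<epsilon>"
    using padic_continuousD[OF assms(2) \<open>\<epsilon> > 0\<close>] by blast
  have "padic_abs (f (n + i * p ^ max N N') + g (n + i * p ^ max N N') - (f n + g n)) < \<epsilon>" for n i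
  proof -
    let ?n = "n + i * p ^ max N N'"
    have "f ?n + g ?n - (f n + g n) = (f ?n - f n) + (g ?n - g n)" by simp
    also have "padic_abs \<dots> < \<epsilon>"
      using N[of "max N N'" n i] N'[of "max N N'" n i]
      by (intro le_less_trans[OF abs_add_le_max]) simp
    finally show ?thesis .
  qed
  then show "\<exists>N. \<forall>n i. padic_abs (f (n + i * p ^ N) + g (n + i * p ^ N) - (f n + g n)) < \<epsilon>"
    by blast
qed

lemma padic_continuous_mult:
  assumes "padic_continuous f" "padic_continuous g"
  shows "padic_continuous (\<lambda>n. f n * g n)"
  unfolding padic_continuous_def
proof (intro allI impI)
  fix \<epsilon> :: real assume "\<epsilon> > 0"
  obtain B where B: "B > 0" "\<And>n. padic_abs (f n) \<le> B"
    using padic_continuous_bounded[OF assms(1)] by blast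
  obtain C where C: "C > 0" "\<And>n. padic_abs (g n) \<le> C"
    using padic_continuous_bounded[OF assms(2)] by blast
  have "\<epsilon> / C > 0" "\<epsilon> / B > 0" using \<open>\<epsilon> > 0\<close> B(1) C(1) by simp_all
  obtain N where N: "\<And>M n i. M \<ge> N \<Longrightarrow> padic_abs (f (n + i * p ^ M) - f n) < \<epsilon> / C"
    using padic_continuousD[OF assms(1) \<open>\<epsilon> / C > 0\<close>] by blast
  obtain N' where N': "\<And>M n i. M \<ge> N' \<Longrightarrow> padic_abs (g (n + i * p ^ M) - g n) < \<epsilon> / B"
    using padic_continuousD[OF assms(2) \<open>\<epsilon> / B > 0\<close>] by blast
  have "padic_abs (f (n + i * p ^ max N N') * g (n + i * p ^ max N N') - f n * g n) < \<epsilon>" for n i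
  proof -
    let ?n = "n + i * p ^ max N N'"
    have "padic_abs (f ?n * (g ?n - g n)) \<le> B * padic_abs (g ?n - g n)"
      using B(2)[of ?n] by (simp add: abs_mult mult_right_mono)
    also have "\<dots> < B * (\<epsilon> / B)"
      using N'[of "max N N'" n i] B(1) by (intro mult_strict_left_mono) auto
    finally have 1: "padic_abs (f ?n * (g ?n - g n)) < \<epsilon>" using B(1) by simp
    have "padic_abs ((f ?n - f n) * g n) \<le> padic_abs (f ?n - f n) * C"
      using C(2)[of n] by (simp add: abs_mult mult_left_mono)
    also have "\<dots> < \<epsilon> / C * C"
      using N[of "max N N'" n i] C(1) by (intro mult_strict_right_mono) auto
    finally have 2: "padic_abs ((f ?n - f n) * g n) < \<epsilon>" using C(1) by simp
    have "f ?n * g ?n - f n * g n = f ?n * (g ?n - g n) + (f ?n - f n) * g n"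
      by (simp add: algebra_simps)
    also have "padic_abs \<dots> < \<epsilon>"
      using 1 2 by (intro le_less_trans[OF abs_add_le_max]) simp
    finally show ?thesis .
  qed
  then show "\<exists>N. \<forall>n i. padic_abs (f (n + i * p ^ N) * g (n + i * p ^ N) - f n * g n) < \<epsilon>"
    by blast
qed

lemma padic_continuous_sum:
  assumes "\<And>j. j \<in> J \<Longrightarrow> padic_continuous (f j)"
  shows "padic_continuous (\<lambda>n. \<Sum>j\<in>J. f j n)"
  using assms
  by (induction J rule: infinite_finite_induct)
    (simp_all add: padic_continuous_const padic_continuous_add)

lemma padic_continuous_power:
  assumes "padic_continuous f"
  shows "padic_continuous (\<lambda>n. f n ^ m)"
  by (induction m) (simp_all add: padic_continuous_const padic_continuous_mult assms)

text \<open>Splitting \<open>{..<p ^ M}\<close> into the translates of \<open>{..<p ^ N}\<close> by multiples of \<open>p ^ N\<close> gives an odd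
  number of blocks with alternating signs, each close to the block starting at 0.\<close>

lemma alternating_sum_convergent:
  assumes "odd p" "padic_continuous f"
  shows "convergent (\<lambda>N. \<Sum>n<p ^ N. f n * (- 1) ^ n)"
proof (rule convergent_padicI)
  let ?S = "\<lambda>N. \<Sum>n<p ^ N. f n * (- 1) ^ n"
  fix \<epsilon> :: real assume "\<epsilon> > 0"
  then obtain N where N: "\<And>n i. padic_abs (f (n + i * p ^ N) - f n) < \<epsilon> / 2"
    using assms(2) unfolding padic_continuous_def by (meson half_gt_zero)
  have "padic_abs (?S M - ?S N) < \<epsilon>" if "M \<ge> N" for M
  proof -
    let ?K = "p ^ (M - N)"
    have pM: "p ^ M = ?K * p ^ N" using that by (simp flip: power_add)
    have sign: "(- 1 :: 'a) ^ (n + i * p ^ N) = (- 1) ^ i * (- 1) ^ n" for n i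
      using assms(1) by (simp add: power_add mult.commute[of i] power_mult)
    have block: "sum g {i * p ^ N..<i * p ^ N + p ^ N} = (\<Sum>n<p ^ N. g (n + i * p ^ N))"
      for i and g :: "nat \<Rightarrow> 'a"
      using sum.shift_bounds_nat_ivl[of g 0 "i * p ^ N" "p ^ N"]
      by (simp add: lessThan_atLeast0 add.commute)
    have "?S M = (\<Sum>i<?K. \<Sum>n<p ^ N. f (n + i * p ^ N) * ((- 1) ^ i * (- 1) ^ n))"
      unfolding pM sum.nat_group[symmetric] block sign ..
    moreover have "?S N = (\<Sum>i<?K. \<Sum>n<p ^ N. f n * ((- 1) ^ i * (- 1) ^ n))"
    proof -
      have alt: "(\<Sum>i<n. (- 1 :: 'a) ^ i) = (if odd n then 1 else 0)" for n
        by (induction n) auto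
      have "(\<Sum>i<?K. \<Sum>n<p ^ N. f n * ((- 1) ^ i * (- 1) ^ n)) = (\<Sum>i<?K. (- 1) ^ i * ?S N)"
        by (simp add: sum_distrib_left mult.left_commute)
      also have "\<dots> = ?S N"
        unfolding sum_distrib_right[symmetric] alt using assms(1) by simp
      finally show ?thesis ..
    qed
    ultimately have "?S M - ?S N
        = (\<Sum>i<?K. \<Sum>n<p ^ N. (f (n + i * p ^ N) - f n) * ((- 1) ^ i * (- 1) ^ n))"
      by (simp only: sum_subtractf[symmetric] left_diff_distrib)
    also have "padic_abs \<dots> \<le> \<epsilon> / 2"
      using \<open>\<epsilon> > 0\<close> N
      by (intro abs_sum_le) (simp_all only: abs_mult abs_neg_one_power mult_1_right less_imp_le half_gt_zero)
    finally show ?thesis using \<open>\<epsilon> > 0\<close> by simp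
  qed
  then show "\<exists>N. \<forall>M\<ge>N. padic_abs (?S M - ?S N) < \<epsilon>" by blast
qed

end

section \<open>The fermionic integral\<close>

locale fermionic_setting = padic_complex_field p for p +
  fixes q :: "'a::{field_char_0, complete_space}"
  assumes odd_p: "odd p"
    and q_near_1: "padic_abs (1 - q) < exp_radius"
begin

lemma abs_mult_log_less:
  assumes "padic_abs (x::'a) \<le> 1"
  shows "padic_abs (x * padic_log q) < exp_radius"
proof -
  have "padic_abs (x * padic_log q) \<le> padic_abs (padic_log q)"
    using assms by (simp add: abs_mult mult_left_le_one_le)
  then show ?thesis using abs_padic_log_le[OF q_near_1] q_near_1 by linarith
qed

lemma qpow_add:
  assumes "padic_abs (x::'a) \<le> 1" "padic_abs y \<le> 1"
  shows "qpow q (x + y) = qpow q x * qpow q y"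
  unfolding qpow_def distrib_right using assms by (intro padic_exp_add abs_mult_log_less)

lemma abs_qpow_minus_1_le:
  assumes "padic_abs (x::'a) \<le> 1"
  shows "padic_abs (qpow q x - 1) \<le> padic_abs x"
proof -
  have "padic_abs (qpow q x - 1) \<le> padic_abs (x * padic_log q)"
    unfolding qpow_def by (intro abs_padic_exp_minus_1_le abs_mult_log_less assms)
  also have "\<dots> \<le> padic_abs x"
    using abs_padic_log_le[OF q_near_1] q_near_1 exp_radius_less_1 by (simp add: abs_mult mult_left_le)
  finally show ?thesis .
qed

lemma abs_qpow_minus_1_less:
  assumes "padic_abs (x::'a) \<le> 1"
  shows "padic_abs (qpow q x - 1) < 1"
proof -
  have "padic_abs (qpow q x - 1) \<le> padic_abs (x * padic_log q)"
    unfolding qpow_def by (intro abs_padic_exp_minus_1_le abs_mult_log_less assms)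
  then show ?thesis using abs_mult_log_less[OF assms] exp_radius_less_1 by linarith
qed

lemma abs_qpow_le_1:
  assumes "padic_abs (x::'a) \<le> 1"
  shows "padic_abs (qpow q x) \<le> 1"
  using abs_add_le_max[of "qpow q x - 1" 1] abs_qpow_minus_1_less[OF assms] by simp

lemma qpow_0: "qpow q (0::'a) = 1"
  using abs_qpow_minus_1_le[of 0] by simp

lemma qpow_of_nat_mult:
  assumes "padic_abs (x::'a) \<le> 1"
  shows "qpow q (of_nat n * x) = qpow q x ^ n"
proof (induction n)
  case (Suc n)
  have "padic_abs (of_nat n * x) \<le> 1"
    using assms abs_of_nat_le_1[of n] by (simp add: abs_mult mult_le_one)
  then show ?case using Suc assms by (simp add: distrib_right qpow_add)
qed (simp add: qpow_0)

lemma qpow_q_eq_1: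
  assumes "q = 1"
  shows "qpow q (x::'a) = 1"
proof -
  have "padic_log q = 0"
    using abs_padic_log_le[OF q_near_1] assms by simp
  then have "qpow q x = qpow q 0" by (simp add: qpow_def)
  then show ?thesis by (simp add: qpow_0)
qed

lemma qnum_add:
  assumes "padic_abs (x::'a) \<le> 1" "padic_abs y \<le> 1"
  shows "qnum q (x + y) = qnum q x + qpow q x * qnum q y"
proof (cases "q = 1")
  case True
  then show ?thesis using qpow_q_eq_1 by (simp add: qnum_def)
next
  case False
  then have "1 - q \<noteq> 0" by simp
  then show ?thesis
    using False by (simp add: qnum_def qpow_add[OF assms] field_simps)
qed

lemma abs_qnum_le:
  obtains C where "C > 0" "\<And>x::'a. padic_abs x \<le> 1 \<Longrightarrow> padic_abs (qnum q x) \<le> C * padic_abs x"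
proof (cases "q = 1")
  case True
  then show ?thesis using that[of 1] by (simp add: qnum_def)
next
  case False
  then have pos: "padic_abs (1 - q) > 0" by simp
  show ?thesis
  proof (rule that[of "1 / padic_abs (1 - q)"])
    fix x :: 'a assume "padic_abs x \<le> 1"
    then show "padic_abs (qnum q x) \<le> 1 / padic_abs (1 - q) * padic_abs x"
      using False pos abs_qpow_minus_1_le[of x]
      by (simp add: qnum_def abs_divide divide_right_mono abs_diff_commute[of 1 "qpow q x"])
  qed (use pos in simp)
qed

lemma abs_of_nat_p_power_le: "padic_abs (of_nat (i * p ^ N) :: 'a) \<le> (1 / real p) ^ N"
  using abs_of_nat_le_1[of i] by (simp add: abs_mult abs_power abs_p mult_left_le_one_le)

lemma p_power_tendsto_0: "(\<lambda>N. (1 / real p) ^ N) \<longlonglongrightarrow> 0"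
  using p_gt_1 by (intro LIMSEQ_realpow_zero) auto

lemma padic_continuous_lipschitz:
  assumes C: "C > 0"
    and f: "\<And>n i. padic_abs (f (n + i) - f n :: 'a) \<le> C * padic_abs (of_nat i :: 'a)"
  shows "padic_continuous f"
  unfolding padic_continuous_def
proof (intro allI impI)
  fix \<epsilon> :: real assume "\<epsilon> > 0"
  then have "\<epsilon> / C > 0" using C by simp
  then obtain N where N: "(1 / real p) ^ N < \<epsilon> / C"
    using order_tendstoD(2)[OF p_power_tendsto_0] unfolding eventually_sequentially by blast
  have "padic_abs (f (n + i * p ^ N) - f n) < \<epsilon>" for n i
  proof -
    have "padic_abs (of_nat (i * p ^ N) :: 'a) < \<epsilon> / C"
      using abs_of_nat_p_power_le[of i N] N by linarith
    then have "C * padic_abs (of_nat (i * p ^ N) :: 'a) < \<epsilon>"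
      using C by (simp only: less_divide_eq mult.commute if_True)
    then show ?thesis using f[of n "i * p ^ N"] by linarith
  qed
  then show "\<exists>N. \<forall>n i. padic_abs (f (n + i * p ^ N) - f n) < \<epsilon>" by blast
qed

lemma padic_continuous_qpow: "padic_continuous (\<lambda>n. qpow q (of_nat n))"
proof (rule padic_continuous_lipschitz[of 1])
  fix n i
  have "qpow q (of_nat (n + i)) - qpow q (of_nat n) = qpow q (of_nat n) * (qpow q (of_nat i) - 1)"
    by (simp add: qpow_add abs_of_nat_le_1 algebra_simps)
  also have "padic_abs \<dots> \<le> 1 * padic_abs (of_nat i :: 'a)"
    unfolding abs_mult by (intro mult_mono abs_qpow_le_1 abs_qpow_minus_1_le abs_of_nat_le_1) auto
  finally show "padic_abs (qpow q (of_nat (n + i)) - qpow q (of_nat n)) \<le> 1 * padic_abs (of_nat i :: 'a)" .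
qed simp

lemma padic_continuous_qnum:
  assumes "padic_abs x \<le> 1"
  shows "padic_continuous (\<lambda>n. qnum q (x + of_nat n))"
proof -
  obtain C where C: "C > 0" "\<And>x. padic_abs x \<le> 1 \<Longrightarrow> padic_abs (qnum q x) \<le> C * padic_abs x"
    using abs_qnum_le by blast
  show ?thesis
  proof (rule padic_continuous_lipschitz[OF C(1)])
    fix n i
    have x: "padic_abs (x + of_nat n) \<le> 1"
      using abs_add_le_max[of x "of_nat n"] assms abs_of_nat_le_1[of n] by simp
    have "qnum q (x + of_nat (n + i)) - qnum q (x + of_nat n) = qpow q (x + of_nat n) * qnum q (of_nat i)"
      using qnum_add[OF x abs_of_nat_le_1[of i]] by (simp add: add.assoc)
    also have "padic_abs \<dots> \<le> 1 * (C * padic_abs (of_nat i :: 'a))"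
      unfolding abs_mult by (intro mult_mono abs_qpow_le_1 C(2) x abs_of_nat_le_1) auto
    finally show "padic_abs (qnum q (x + of_nat (n + i)) - qnum q (x + of_nat n))
        \<le> C * padic_abs (of_nat i :: 'a)" by simp
  qed
qed

lemma normalizing_factor_convergent:
  "convergent (\<lambda>N. (1 + q) / (1 + qpow q (of_nat (p ^ N))))"
proof -
  let ?u = "\<lambda>N. qpow q (of_nat (p ^ N)) - 1"
  have "coprime 2 p" using odd_p by simp
  then have abs_2: "padic_abs (2::'a) = 1"
    using abs_of_nat_coprime[of 2] by simp
  have abs_u: "padic_abs (?u N) < 1" for N
    by (intro abs_qpow_minus_1_less abs_of_nat_le_1)
  have abs_den: "padic_abs (2 + ?u N) \<ge> 1" for N
    using abs_diff_le_max[of "2 + ?u N" "?u N"] abs_u[of N] abs_2 by simp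
  have "(\<lambda>N. (1 + q) / (2 + ?u N)) \<longlonglongrightarrow> (1 + q) / 2"
  proof (rule tendsto_padic_le)
    fix N
    have "2 + ?u N \<noteq> 0" using abs_den[of N] by (metis dist_self not_one_le_zero)
    then have "(1 + q) / (2 + ?u N) - (1 + q) / 2 = - ((1 + q) * ?u N / (2 * (2 + ?u N)))"
      by (simp add: divide_simps) (simp add: algebra_simps)
    also have "padic_abs \<dots> = padic_abs (1 + q) * padic_abs (?u N) / padic_abs (2 + ?u N)"
      unfolding abs_minus abs_divide abs_mult abs_2 by simp
    also have "\<dots> \<le> padic_abs (1 + q) * padic_abs (?u N) / 1"
      using abs_den[of N] by (intro divide_left_mono) auto
    also have "\<dots> \<le> padic_abs (1 + q) * (1 / real p) ^ N"
      using order_trans[OF abs_qpow_minus_1_le[OF abs_of_nat_le_1] abs_of_nat_p_power_le[of 1]]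
      by (simp add: mult_left_mono)
    finally show "padic_abs ((1 + q) / (2 + ?u N) - (1 + q) / 2) \<le> padic_abs (1 + q) * (1 / real p) ^ N" .
    show "(\<lambda>N. padic_abs (1 + q) * (1 / real p) ^ N) \<longlonglongrightarrow> 0"
      using tendsto_mult_left[OF p_power_tendsto_0] by fastforce
  qed
  moreover have "2 + ?u N = 1 + qpow q (of_nat (p ^ N))" for N by simp
  ultimately show ?thesis unfolding convergent_def by (intro exI) simp
qed

lemma fermionic_integral_limit:
  assumes "padic_continuous (\<lambda>n. f (of_nat n))"
  shows "(\<lambda>N. (1 + q) / (1 + qpow q (of_nat (p ^ N))) *
      (\<Sum>n<p ^ N. f (of_nat n) * (- 1) ^ n * qpow q (of_nat n))) \<longlonglongrightarrow> fermionic_integral p q f"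
proof -
  have "convergent (\<lambda>N. \<Sum>n<p ^ N. f (of_nat n) * qpow q (of_nat n) * (- 1) ^ n)"
    using odd_p by (intro alternating_sum_convergent padic_continuous_mult assms padic_continuous_qpow)
  then have "convergent (\<lambda>N. \<Sum>n<p ^ N. f (of_nat n) * (- 1) ^ n * qpow q (of_nat n))"
    by (simp add: mult.assoc mult.commute[of "qpow q _"])
  with normalizing_factor_convergent
  have "convergent (\<lambda>N. (1 + q) / (1 + qpow q (of_nat (p ^ N))) *
      (\<Sum>n<p ^ N. f (of_nat n) * (- 1) ^ n * qpow q (of_nat n)))"
    unfolding convergent_def by (elim exE) (intro exI, rule tendsto_mult_padic)
  then show ?thesis
    unfolding fermionic_integral_def convergent_LIMSEQ_iff .
qed

lemma fermionic_integral_sum: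
  assumes "\<And>j. j \<in> J \<Longrightarrow> padic_continuous (\<lambda>n. f j (of_nat n))"
  shows "fermionic_integral p q (\<lambda>t. \<Sum>j\<in>J. c j * f j t) = (\<Sum>j\<in>J. c j * fermionic_integral p q (f j))"
proof -
  let ?a = "\<lambda>N. (1 + q) / (1 + qpow q (of_nat (p ^ N)))"
  have "(\<lambda>N. \<Sum>j\<in>J. c j * (?a N * (\<Sum>n<p ^ N. f j (of_nat n) * (- 1) ^ n * qpow q (of_nat n))))
      \<longlonglongrightarrow> (\<Sum>j\<in>J. c j * fermionic_integral p q (f j))"
    by (intro tendsto_sum_padic tendsto_mult_padic[OF tendsto_const] fermionic_integral_limit assms)
  moreover have "(\<Sum>j\<in>J. c j * (?a N * (\<Sum>n<p ^ N. f j (of_nat n) * (- 1) ^ n * qpow q (of_nat n))))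
      = ?a N * (\<Sum>n<p ^ N. (\<Sum>j\<in>J. c j * f j (of_nat n)) * (- 1) ^ n * qpow q (of_nat n))" for N
  proof -
    have "(\<Sum>n<p ^ N. (\<Sum>j\<in>J. c j * f j (of_nat n)) * (- 1) ^ n * qpow q (of_nat n))
        = (\<Sum>n<p ^ N. \<Sum>j\<in>J. c j * (f j (of_nat n) * (- 1) ^ n * qpow q (of_nat n)))"
      by (simp add: sum_distrib_right mult.assoc)
    also have "\<dots> = (\<Sum>j\<in>J. c j * (\<Sum>n<p ^ N. f j (of_nat n) * (- 1) ^ n * qpow q (of_nat n)))"
      unfolding sum_distrib_left by (rule sum.swap)
    finally show ?thesis
      by (simp only: sum_distrib_left[of "?a N" _ J] mult.left_commute[of "?a N"])
  qed
  ultimately show ?thesis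
    unfolding fermionic_integral_def[of p q "\<lambda>t. \<Sum>j\<in>J. c j * f j t"] by (simp only: limI)
qed

lemma fermionic_integral_cong:
  assumes "\<And>n. f (of_nat n) = g (of_nat n)"
  shows "fermionic_integral p q f = fermionic_integral p q g"
  unfolding fermionic_integral_def assms ..

section \<open>Iterated integrals\<close>

primrec iter_continuous :: "nat \<Rightarrow> ((nat \<Rightarrow> 'a) \<Rightarrow> 'a) \<Rightarrow> bool" where
  "iter_continuous 0 F \<longleftrightarrow> True"
| "iter_continuous (Suc k) F \<longleftrightarrow>
     (\<forall>n. iter_continuous k (\<lambda>y. F (y(Suc k := of_nat n)))) \<and>
     padic_continuous (\<lambda>n. iterated_integral p q k (\<lambda>y. F (y(Suc k := of_nat n))))"

lemma iterated_integral_cong: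
  assumes "\<And>y. range y \<subseteq> \<nat> \<Longrightarrow> F y = G y"
  shows "iterated_integral p q k F = iterated_integral p q k G"
  using assms
proof (induction k arbitrary: F G)
  case 0
  have "range (\<lambda>_::nat. 0::'a) \<subseteq> \<nat>" by auto
  then show ?case using 0 by simp
next
  case (Suc k)
  have "iterated_integral p q k (\<lambda>y. F (y(Suc k := of_nat n)))
      = iterated_integral p q k (\<lambda>y. G (y(Suc k := of_nat n)))" for n
    by (intro Suc.IH Suc.prems) (auto simp: image_subset_iff)
  then show ?case by (auto intro: fermionic_integral_cong)
qed

lemma iter_continuous_cong:
  assumes "\<And>y. range y \<subseteq> \<nat> \<Longrightarrow> F y = G y"
  shows "iter_continuous k F \<longleftrightarrow> iter_continuous k G"
  using assms
proof (induction k arbitrary: F G)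
  case (Suc k)
  have *: "F (y(Suc k := of_nat n)) = G (y(Suc k := of_nat n))" if "range y \<subseteq> \<nat>" for y n
    using that by (intro Suc.prems) (auto simp: image_subset_iff)
  have "iter_continuous k (\<lambda>y. F (y(Suc k := of_nat n)))
      = iter_continuous k (\<lambda>y. G (y(Suc k := of_nat n)))" for n
    by (intro Suc.IH *)
  moreover have "iterated_integral p q k (\<lambda>y. F (y(Suc k := of_nat n)))
      = iterated_integral p q k (\<lambda>y. G (y(Suc k := of_nat n)))" for n
    by (intro iterated_integral_cong *)
  ultimately show ?case by simp
qed simp

lemma iterated_integral_sum_aux:
  assumes "\<And>j. j \<in> J \<Longrightarrow> iter_continuous k (G j)"
  shows "iter_continuous k (\<lambda>y. \<Sum>j\<in>J. c j * G j y) \<and>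
    iterated_integral p q k (\<lambda>y. \<Sum>j\<in>J. c j * G j y) = (\<Sum>j\<in>J. c j * iterated_integral p q k (G j))"
  using assms
proof (induction k arbitrary: G)
  case (Suc k)
  let ?G = "\<lambda>n j y. G j (y(Suc k := of_nat n))"
  have "iter_continuous k (?G n j)" if "j \<in> J" for j n
    using Suc.prems that by simp
  then have "iter_continuous k (\<lambda>y. \<Sum>j\<in>J. c j * ?G n j y) \<and>
      iterated_integral p q k (\<lambda>y. \<Sum>j\<in>J. c j * ?G n j y) = (\<Sum>j\<in>J. c j * iterated_integral p q k (?G n j))"
    for n by (intro Suc.IH)
  then have IH: "iter_continuous k (\<lambda>y. \<Sum>j\<in>J. c j * ?G n j y)"
    "iterated_integral p q k (\<lambda>y. \<Sum>j\<in>J. c j * ?G n j y) = (\<Sum>j\<in>J. c j * iterated_integral p q k (?G n j))"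
    for n by blast+
  have outer: "padic_continuous (\<lambda>n. iterated_integral p q k (?G n j))" if "j \<in> J" for j
    using Suc.prems that by simp
  have "padic_continuous (\<lambda>n. \<Sum>j\<in>J. c j * iterated_integral p q k (?G n j))"
    by (intro padic_continuous_sum padic_continuous_mult padic_continuous_const outer)
  then have "iter_continuous (Suc k) (\<lambda>y. \<Sum>j\<in>J. c j * G j y)"
    by (simp add: IH)
  moreover have "iterated_integral p q (Suc k) (\<lambda>y. \<Sum>j\<in>J. c j * G j y)
      = fermionic_integral p q (\<lambda>t. \<Sum>j\<in>J. c j * iterated_integral p q k (\<lambda>y. G j (y(Suc k := t))))"
    unfolding iterated_integral.simps by (rule fermionic_integral_cong) (rule IH)
  ultimately show ?case
    by (simp add: fermionic_integral_sum outer)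
qed simp

lemmas iter_continuous_sum = iterated_integral_sum_aux[THEN conjunct1]
lemmas iterated_integral_sum = iterated_integral_sum_aux[THEN conjunct2]

lemma iterated_integral_innermost:
  "iterated_integral p q (Suc k) F =
     iterated_integral p q k (\<lambda>y. fermionic_integral p q (\<lambda>t. F (\<lambda>i. if i = 1 then t else y (i - 1))))"
proof (induction k arbitrary: F)
  case 0
  have "(\<lambda>_. 0)(Suc 0 := t) = (\<lambda>i. if i = 1 then t else 0)" for t :: 'a
    by auto
  then show ?case by simp
next
  case (Suc k)
  have "(\<lambda>i. if i = 1 then t else y (i - 1))(Suc (Suc k) := s)
      = (\<lambda>i. if i = 1 then t else (y(Suc k := s)) (i - 1))" for s t and y :: "nat \<Rightarrow> 'a"
    by (rule ext) (auto split: if_splits)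
  then show ?case
    by (subst iterated_integral.simps(2), subst Suc.IH) (simp only: iterated_integral.simps(2))
qed

section \<open>The higher-order q-Euler numbers\<close>

lemma qnum_add_power:
  assumes "padic_abs (x::'a) \<le> 1" "padic_abs y \<le> 1"
  shows "qnum q (x + y) ^ m
    = (\<Sum>j\<le>m. of_nat (m choose j) * qpow q (of_nat j * x) * qnum q x ^ (m - j) * qnum q y ^ j)"
proof -
  have "qnum q (x + y) ^ m = (qpow q x * qnum q y + qnum q x) ^ m"
    using qnum_add[OF assms] by (simp add: add.commute)
  also have "\<dots> = (\<Sum>j\<le>m. of_nat (m choose j) * (qpow q x * qnum q y) ^ j * qnum q x ^ (m - j))"
    by (rule binomial_ring)
  finally show ?thesis
    unfolding qpow_of_nat_mult[OF assms(1)] by (simp add: power_mult_distrib mult_ac)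
qed

lemma sum_weighted_nat:
  assumes "range y \<subseteq> (\<nat> :: 'a set)"
  obtains n where "(\<Sum>i\<in>A. of_nat (w i) * y i) = of_nat n"
proof -
  have "(\<Sum>i\<in>A. of_nat (w i) * y i) \<in> \<nat>"
    using assms by (induction A rule: infinite_finite_induct) (auto intro!: Nats_add Nats_mult)
  then show ?thesis using that by (auto elim: Nats_cases)
qed

lemma iter_continuous_qnum_qpow:
  "iter_continuous k (\<lambda>y. qnum q (\<Sum>i=1..k. y i) ^ m * qpow q (\<Sum>i=1..k. of_nat (w i) * y i))"
proof (induction k arbitrary: m)
  case (Suc k)
  let ?F = "\<lambda>k m y. qnum q (\<Sum>i=1..k. y i) ^ m * qpow q (\<Sum>i=1..k. of_nat (w i) * y i)"
  let ?c = "\<lambda>n j. of_nat (m choose j) * qpow q (of_nat n) ^ j * qnum q (0 + of_nat n) ^ (m - j)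
      * qpow q (of_nat n) ^ w (Suc k)"
  have expand: "?F (Suc k) m (y(Suc k := of_nat n)) = (\<Sum>j\<le>m. ?c n j * ?F k j y)"
    if y: "range y \<subseteq> \<nat>" for y n
  proof -
    obtain a where a: "(\<Sum>i=1..k. y i) = of_nat a"
      using sum_weighted_nat[OF y, of "\<lambda>_. 1"] by auto
    obtain b where b: "(\<Sum>i=1..k. of_nat (w i) * y i) = of_nat b"
      using sum_weighted_nat[OF y, of w] by auto
    have upd: "(\<Sum>i=1..k. g i ((y(Suc k := of_nat n)) i)) = (\<Sum>i=1..k. g i (y i))"
      for g :: "nat \<Rightarrow> 'a \<Rightarrow> 'a"
      by (intro sum.cong) auto
    have "?F (Suc k) m (y(Suc k := of_nat n))
        = qnum q (of_nat n + of_nat a) ^ m * qpow q (of_nat b + of_nat (w (Suc k)) * of_nat n)"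
      using upd[of "\<lambda>_ u. u"] upd[of "\<lambda>i u. of_nat (w i) * u"]
      by (simp add: a[simplified] b[simplified] add.commute)
    also have "qpow q (of_nat b + of_nat (w (Suc k)) * of_nat n)
        = qpow q (of_nat b) * qpow q (of_nat n) ^ w (Suc k)"
      using qpow_add[OF abs_of_nat_le_1 abs_of_nat_le_1[of "w (Suc k) * n"], of b]
      by (simp add: qpow_of_nat_mult abs_of_nat_le_1)
    finally show ?thesis
      unfolding qnum_add_power[OF abs_of_nat_le_1 abs_of_nat_le_1] a b
      by (simp add: sum_distrib_right sum_distrib_left qpow_of_nat_mult abs_of_nat_le_1 mult_ac)
  qed
  have "iter_continuous k (\<lambda>y. ?F (Suc k) m (y(Suc k := of_nat n)))" for n
    by (rule iffD2[OF iter_continuous_cong], rule expand, assumption)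
      (rule iter_continuous_sum[OF Suc.IH])
  moreover have "iterated_integral p q k (\<lambda>y. ?F (Suc k) m (y(Suc k := of_nat n)))
      = (\<Sum>j\<le>m. ?c n j * iterated_integral p q k (?F k j))" for n
    by (rule trans[OF iterated_integral_cong], rule expand, assumption)
      (rule iterated_integral_sum[OF Suc.IH])
  moreover have "padic_continuous (\<lambda>n. \<Sum>j\<le>m. ?c n j * iterated_integral p q k (?F k j))"
    by (intro padic_continuous_sum padic_continuous_mult padic_continuous_power padic_continuous_const
        padic_continuous_qpow padic_continuous_qnum) simp
  ultimately show ?case by simp
qed simp

lemma qEuler_one:
  "qEuler p q h 1 m x = fermionic_integral p q (\<lambda>t. qnum q (x + t) ^ m * qpow q (of_int (h - 1) * t))"
  by (simp add: qEuler_def)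

lemma qEuler_Suc:
  assumes x: "padic_abs x \<le> 1"
  shows "qEuler p q (int (Suc k)) (Suc k) m x =
    (\<Sum>j\<le>m. of_nat (m choose j) * qpow q (of_nat j * x) *
       qEuler p q (int (Suc k + j)) 1 (m - j) x * qEuler p q (int k) k j 0)"
proof -
  let ?W = "\<lambda>y. \<Sum>i=1..k. of_int (int k - int i) * y i"
  let ?G = "\<lambda>j y. qnum q (\<Sum>i=1..k. y i) ^ j * qpow q (?W y)"
  let ?f = "\<lambda>j t. qnum q (x + t) ^ (m - j) * qpow q (of_int (int (Suc k + j) - 1) * t)"
  let ?c = "\<lambda>j. of_nat (m choose j) * qpow q (of_nat j * x)"
  have W: "?W y = (\<Sum>i=1..k. of_nat (k - i) * y i)" for y :: "nat \<Rightarrow> 'a"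
    by (intro sum.cong) (auto simp: of_nat_diff)
  have shift: "(\<Sum>i=1..Suc k. g i (if i = 1 then t else y (i - 1))) = g 1 t + (\<Sum>i=1..k. g (Suc i) (y i))"
    for g :: "nat \<Rightarrow> 'a \<Rightarrow> 'a" and t y
  proof -
    have "(\<Sum>i=Suc 1..Suc k. g i (if i = 1 then t else y (i - 1))) = (\<Sum>i=1..k. g (Suc i) (y i))"
      unfolding sum.shift_bounds_cl_Suc_ivl by (intro sum.cong) auto
    then show ?thesis
      using sum.atLeast_Suc_atMost[of 1 "Suc k" "\<lambda>i. g i (if i = 1 then t else y (i - 1))"] by simp
  qed
  have cont: "padic_continuous (\<lambda>n. ?f j (of_nat n))" for j
  proof -
    have "qpow q (of_int (int (Suc k + j) - 1) * of_nat n) = qpow q (of_nat n) ^ (k + j)" for n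
      using qpow_of_nat_mult[OF abs_of_nat_le_1, of "k + j" n] by simp
    then show ?thesis
      by (simp only:) (intro padic_continuous_mult padic_continuous_power padic_continuous_qpow
          padic_continuous_qnum x)
  qed
  have inner: "fermionic_integral p q (\<lambda>t. qnum q (x + (\<Sum>i=1..Suc k. if i = 1 then t else y (i - 1))) ^ m *
        qpow q (\<Sum>i=1..Suc k. of_int (int (Suc k) - int i) * (if i = 1 then t else y (i - 1))))
      = (\<Sum>j\<le>m. ?c j * qEuler p q (int (Suc k + j)) 1 (m - j) x * ?G j y)"
    if y: "range y \<subseteq> \<nat>" for y
  proof -
    obtain a where a: "(\<Sum>i=1..k. y i) = of_nat a"
      using sum_weighted_nat[OF y, of "\<lambda>_. 1"] by auto
    obtain b where b: "?W y = of_nat b"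
      using sum_weighted_nat[OF y, of "\<lambda>i. k - i" "{1..k}"] W[of y] by metis
    have "qnum q (x + (\<Sum>i=1..Suc k. if i = 1 then of_nat n else y (i - 1))) ^ m *
        qpow q (\<Sum>i=1..Suc k. of_int (int (Suc k) - int i) * (if i = 1 then of_nat n else y (i - 1)))
      = (\<Sum>j\<le>m. ?c j * ?G j y * ?f j (of_nat n))" for n
    proof -
      have xn: "padic_abs (x + of_nat n) \<le> 1"
        using abs_add_le_max[of x "of_nat n"] x abs_of_nat_le_1[of n] by simp
      have jx: "padic_abs (of_nat j * x) \<le> 1" for j
        using x abs_of_nat_le_1[of j] by (simp add: abs_mult mult_le_one)
      have qpow_nat: "qpow q (of_nat c * of_nat n) = qpow q (of_nat n) ^ c" for c
        by (rule qpow_of_nat_mult[OF abs_of_nat_le_1])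
      have s1: "x + (\<Sum>i=1..Suc k. if i = 1 then of_nat n else y (i - 1)) = (x + of_nat n) + of_nat a"
        unfolding shift[of "\<lambda>_ u. u"] a by simp
      have s2: "(\<Sum>i=1..Suc k. of_int (int (Suc k) - int i) * (if i = 1 then of_nat n else y (i - 1)))
          = of_nat (k * n) + of_nat b"
        unfolding shift[of "\<lambda>i u. of_int (int (Suc k) - int i) * u"] b[symmetric] by simp
      have e1: "qpow q (of_nat j * (x + of_nat n)) = qpow q (of_nat j * x) * qpow q (of_nat n) ^ j" for j
        using qpow_add[OF jx abs_of_nat_le_1[of "j * n"], of j] by (simp add: distrib_left qpow_nat)
      have e2: "qpow q (of_nat (k * n) + of_nat b) = qpow q (of_nat n) ^ k * qpow q (of_nat b)"
        using qpow_add[OF abs_of_nat_le_1[of "k * n"] abs_of_nat_le_1[of b]] by (simp add: qpow_nat)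
      have e3: "qpow q (of_int (int (Suc k + j) - 1) * of_nat n) = qpow q (of_nat n) ^ (k + j)" for j
        using qpow_nat[of "k + j"] by simp
      show ?thesis
        unfolding s1 s2 qnum_add_power[OF xn abs_of_nat_le_1] e1 e2 e3 a b sum_distrib_right
        by (intro sum.cong refl) (simp add: power_add mult_ac)
    qed
    then have "fermionic_integral p q (\<lambda>t. qnum q (x + (\<Sum>i=1..Suc k. if i = 1 then t else y (i - 1))) ^ m *
        qpow q (\<Sum>i=1..Suc k. of_int (int (Suc k) - int i) * (if i = 1 then t else y (i - 1))))
      = fermionic_integral p q (\<lambda>t. \<Sum>j\<le>m. ?c j * ?G j y * ?f j t)"
      by (rule fermionic_integral_cong)
    also have "\<dots> = (\<Sum>j\<le>m. ?c j * ?G j y * fermionic_integral p q (?f j))"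
      by (intro fermionic_integral_sum cont)
    finally show ?thesis
      unfolding qEuler_one by (simp only: mult_ac)
  qed
  have "qEuler p q (int (Suc k)) (Suc k) m x
      = iterated_integral p q k (\<lambda>y. \<Sum>j\<le>m. ?c j * qEuler p q (int (Suc k + j)) 1 (m - j) x * ?G j y)"
    unfolding qEuler_def[of p q "int (Suc k)" "Suc k"] iterated_integral_innermost
    by (rule iterated_integral_cong) (rule inner)
  also have "\<dots> = (\<Sum>j\<le>m. ?c j * qEuler p q (int (Suc k + j)) 1 (m - j) x * iterated_integral p q k (?G j))"
    unfolding W by (intro iterated_integral_sum iter_continuous_qnum_qpow)
  finally show ?thesis
    unfolding qEuler_def[of p q "int k" k] by simp
qed

end

theorem theorem7:
  fixes p m k :: nat and q x :: "'a::{field_char_0, complete_space}"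
  assumes "padic_complex_field TYPE('a) p"
    and "odd p"
    and "padic_abs (1 - q) < real p powr (- 1 / (real p - 1))"
    and "m \<ge> 1" and "k \<ge> 1"
    and "x \<in> Zp"
  shows "qEuler p q (int k) k m x =
    (\<Sum>j=0..m. of_nat (m choose j) * qpow q (of_nat j * x) *
       qEuler p q (int (k + j)) 1 (m - j) x * qEuler p q (int (k - 1)) (k - 1) j 0)"
proof -
  interpret padic_complex_field p by fact
  interpret fermionic_setting p q
    by unfold_locales (use assms in \<open>auto simp: exp_radius_def\<close>)
  have "padic_abs x \<le> 1" using assms(6) by (simp add: Zp_def)
  from qEuler_Suc[OF this, of "k - 1" m] show ?thesis
    using assms(5) by (simp add: atLeast0AtMost)
qed

end
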